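(* Let $G$ be a finite group and $n\ge1$. For $1\le m\le n$, $$GZ_{m,n}=\langle Z[\mathbb{C}[G^n]],X_1,X_2,\ldots,X_m\rangle,$$ where $GZ_{m,n}=\langle Z_{1,n},Z_{2,n},\ldots,Z_{m,n}\rangle$.
   Context: $G$ is a finite group with identity $e$. $G_n=G\sim S_n$ (wreath product) is the set of tuples $(g_1,\ldots,g_n,\pi)$ with $g_i\in G$, $\pi\in S_n$, and product $(g_1,\ldots,g_n,\pi)(h_1,\ldots,h_n,\tau)=(g_1h_{\pi^{-1}(1)},\ldots,g_nh_{\pi^{-1}(n)},\pi\tau)$. For $g\in G$, $g^{(i)}\in G_n$ has $g$ in position $i$, $e$ in the other positions, and identity permutation; $\pi\in S_n$ is identified with $(e,\ldots,e,\pi)$; $(k,i)$ denotes a transposition. For $1\le i\le n$, $H_{i,n}=\{(g_1,\ldots,g_n,\pi)\in G_n: \pi(j)=j\text{ for } i+1\le j\le n\}$, so $H_{n,n}=G_n$, and $H_{1,n}$ is identified with $G^n$. $Z[A]$ is the center of an algebra $A$ and $Z_{m,n}=Z[\mathbb{C}[H_{m,n}]]$. The Young-Jucys-Murphy elements are $X_i=\sum_{k=1}^{i-1}\sum_{g\in G}(g^{-1})^{(k)}g^{(i)}(k,i)\in\mathbb{C}[G_n]$, $1\le i\le n$ (so $X_1=0$). $\langle\cdot\rangle$ denotes the generated unital subalgebra. *)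

theory Defs
  imports "HOL-Algebra.Module" "HOL-Algebra.Subrings" "HOL-Algebra.Sym_Groups"
    "HOL-Algebra.Product_Groups"
begin

definition wreath :: "('a, 'b) monoid_scheme \<Rightarrow> nat \<Rightarrow> ((nat \<Rightarrow> 'a) \<times> (nat \<Rightarrow> nat)) monoid"
  where "wreath G n =
    \<lparr> carrier = carrier (product_group {1..n} (\<lambda>_. G)) \<times> carrier (sym_group n),
      monoid.mult = (\<lambda>(g, p) (h, q). ((\<lambda>i\<in>{1..n}. g i \<otimes>\<^bsub>G\<^esub> h (Hilbert_Choice.inv p i)), p \<circ> q)),
      one = ((\<lambda>i\<in>{1..n}. \<one>\<^bsub>G\<^esub>), id) \<rparr>"

definition coord_elt ::
    "('a, 'b) monoid_scheme \<Rightarrow> nat \<Rightarrow> nat \<Rightarrow> 'a \<Rightarrow> (nat \<Rightarrow> 'a) \<times> (nat \<Rightarrow> nat)"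
  where "coord_elt G n i g = ((\<lambda>j\<in>{1..n}. if j = i then g else \<one>\<^bsub>G\<^esub>), id)"

definition perm_elt ::
    "('a, 'b) monoid_scheme \<Rightarrow> nat \<Rightarrow> (nat \<Rightarrow> nat) \<Rightarrow> (nat \<Rightarrow> 'a) \<times> (nat \<Rightarrow> nat)"
  where "perm_elt G n p = ((\<lambda>j\<in>{1..n}. \<one>\<^bsub>G\<^esub>), p)"

definition base_elt :: "(nat \<Rightarrow> 'a) \<Rightarrow> (nat \<Rightarrow> 'a) \<times> (nat \<Rightarrow> nat)"
  where "base_elt g = (g, id)"

definition wreath_subgroup ::
    "('a, 'b) monoid_scheme \<Rightarrow> nat \<Rightarrow> nat \<Rightarrow> ((nat \<Rightarrow> 'a) \<times> (nat \<Rightarrow> nat)) set"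
  where "wreath_subgroup G i n =
    {(g, p). (g, p) \<in> carrier (wreath G n) \<and> (\<forall>j\<in>{i + 1..n}. p j = j)}"

text \<open>The complex group algebra of a finite group: an element is its coefficient function,
  extended by zero outside the carrier. Hence the group algebra of a subgroup \<open>H\<close>,
  taken as \<open>group_algebra (G\<lparr>carrier := H\<rparr>)\<close>, is literally a subset of that of \<open>G\<close>.\<close>

definition group_algebra :: "('x, 'b) monoid_scheme \<Rightarrow> (complex, 'x \<Rightarrow> complex) module"
  where "group_algebra G =
    \<lparr> carrier = {a. \<forall>x. x \<notin> carrier G \<longrightarrow> a x = 0},
      monoid.mult = (\<lambda>a b x. \<Sum>(y, z) | y \<in> carrier G \<and> z \<in> carrier G \<and> y \<otimes>\<^bsub>G\<^esub> z = x. a y * b z),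
      one = (\<lambda>x. if x = \<one>\<^bsub>G\<^esub> then 1 else 0),
      zero = (\<lambda>x. 0),
      ring.add = (\<lambda>a b x. a x + b x),
      module.smult = (\<lambda>c a x. c * a x) \<rparr>"

definition basis_elt :: "'x \<Rightarrow> 'x \<Rightarrow> complex"
  where "basis_elt x = (\<lambda>y. if y = x then 1 else 0)"

text \<open>The linear extension of a map \<open>f\<close> of finite groups to their group algebras.\<close>

definition group_algebra_map ::
    "('x, 'b) monoid_scheme \<Rightarrow> ('x \<Rightarrow> 'y) \<Rightarrow> ('x \<Rightarrow> complex) \<Rightarrow> 'y \<Rightarrow> complex"
  where "group_algebra_map G f a = (\<lambda>y. \<Sum>x | x \<in> carrier G \<and> f x = y. a x)"

definition center :: "('x, 'b) monoid_scheme \<Rightarrow> 'x set"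
  where "center A = {z \<in> carrier A. \<forall>a\<in>carrier A. z \<otimes>\<^bsub>A\<^esub> a = a \<otimes>\<^bsub>A\<^esub> z}"

text \<open>The scalars range over the whole type of complex numbers; \<open>subring\<close> includes the unit.\<close>

definition unital_subalgebra :: "'v set \<Rightarrow> (complex, 'v) module \<Rightarrow> bool"
  where "unital_subalgebra V A \<longleftrightarrow> subring V A \<and> (\<forall>c. \<forall>v\<in>V. c \<odot>\<^bsub>A\<^esub> v \<in> V)"

definition generated_subalgebra :: "(complex, 'v) module \<Rightarrow> 'v set \<Rightarrow> 'v set"
  where "generated_subalgebra A S = \<Inter>{V. unital_subalgebra V A \<and> S \<subseteq> V}"

definition Z_wreath ::
    "('a, 'b) monoid_scheme \<Rightarrow> nat \<Rightarrow> nat \<Rightarrow> ((nat \<Rightarrow> 'a) \<times> (nat \<Rightarrow> nat) \<Rightarrow> complex) set"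
  where "Z_wreath G m n =
    center (group_algebra ((wreath G n)\<lparr>carrier := wreath_subgroup G m n\<rparr>))"

definition GZ_wreath ::
    "('a, 'b) monoid_scheme \<Rightarrow> nat \<Rightarrow> nat \<Rightarrow> ((nat \<Rightarrow> 'a) \<times> (nat \<Rightarrow> nat) \<Rightarrow> complex) set"
  where "GZ_wreath G m n =
    generated_subalgebra (group_algebra (wreath G n)) (\<Union>i\<in>{1..m}. Z_wreath G i n)"

text \<open>The center of the group algebra of the direct power \<open>G ^ n\<close>, viewed inside the group
  algebra of the wreath product via \<open>g \<mapsto> (g, id)\<close>.\<close>

definition Z_base ::
    "('a, 'b) monoid_scheme \<Rightarrow> nat \<Rightarrow> ((nat \<Rightarrow> 'a) \<times> (nat \<Rightarrow> nat) \<Rightarrow> complex) set"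
  where "Z_base G n =
    group_algebra_map (product_group {1..n} (\<lambda>_. G)) base_elt `
      center (group_algebra (product_group {1..n} (\<lambda>_. G)))"

text \<open>The summands are products in the group, viewed as basis elements of its group algebra.\<close>

definition YJM ::
    "('a, 'b) monoid_scheme \<Rightarrow> nat \<Rightarrow> nat \<Rightarrow> (nat \<Rightarrow> 'a) \<times> (nat \<Rightarrow> nat) \<Rightarrow> complex"
  where "YJM G n i =
    (\<Oplus>\<^bsub>group_algebra (wreath G n)\<^esub> k\<in>{1..<i}. \<Oplus>\<^bsub>group_algebra (wreath G n)\<^esub> g\<in>carrier G.
      basis_elt (coord_elt G n k (inv\<^bsub>G\<^esub> g) \<otimes>\<^bsub>wreath G n\<^esub> coord_elt G n i g
        \<otimes>\<^bsub>wreath G n\<^esub> perm_elt G n (transpose k i)))"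

end

theory Submission
  imports Defs
begin

text \<open>
  Write \<open>W\<close> for the wreath product, \<open>H\<^sub>i\<close> for \<open>wreath_subgroup G i n\<close>, \<open>Z\<^sub>i\<close> for the centre of
  its group algebra and \<open>X\<^sub>i\<close> for the Young-Jucys-Murphy elements. A generated subalgebra is an
  intersection, so it suffices that a unital subalgebra \<open>V\<close> contains \<open>Z\<^sub>1, \<dots>, Z\<^sub>m\<close> iff it contains
  the centre of the base group and \<open>X\<^sub>1, \<dots>, X\<^sub>m\<close> (\<open>subalgebra_contains_iff\<close>). Since \<open>H\<^sub>1\<close> is the
  base group and \<open>X\<^sub>1 = 0\<close>, induction on \<open>m\<close> reduces this to one step: when \<open>Z\<^sub>i \<subseteq> V\<close>,
  the inclusion \<open>Z\<^sub>i\<^sub>+\<^sub>1 \<subseteq> V\<close> is equivalent to \<open>X\<^sub>i\<^sub>+\<^sub>1 \<in> V\<close>.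

  One direction is Jucys' observation: \<open>X\<^sub>i\<^sub>+\<^sub>1\<close> is the sum of all twisted transpositions
  \<open>(g\<inverse>)\<^sup>(\<^sup>k\<^sup>) g\<^sup>(\<^sup>j\<^sup>) (k,j)\<close> in \<open>H\<^sub>i\<^sub>+\<^sub>1\<close> minus the sum of all those in \<open>H\<^sub>i\<close>, and both sums are central
  because the twisted transpositions are permuted by conjugation (\<open>YJM_in_subalgebra\<close>).

  For the other direction, let \<open>P(x)\<close> be the sum of \<open>h x h\<inverse>\<close> over \<open>h \<in> H\<^sub>i\<close>. An element of \<open>Z\<^sub>i\<^sub>+\<^sub>1\<close> commutes
  with \<open>H\<^sub>i\<close>, hence is a linear combination of such sums with \<open>x \<in> H\<^sub>i\<^sub>+\<^sub>1\<close> (\<open>conj_sum_average\<close>), and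
  it remains to see that every \<open>P(x)\<close> lies in \<open>V\<close> (\<open>conj_sum_in_subalgebra\<close>). If the permutation
  of \<open>x\<close> fixes \<open>i+1\<close>, then \<open>x \<in> H\<^sub>i\<close> and \<open>P(x) \<in> Z\<^sub>i\<close>. Otherwise \<open>x = y t\<close>, where \<open>t\<close> is one of
  the twisted transpositions \<open>t\<^sub>k\<^sub>,\<^sub>g\<close> of \<open>k\<close> and \<open>i+1\<close> that sum to \<open>X\<^sub>i\<^sub>+\<^sub>1\<close>, and \<open>y\<close> does nothing at \<open>k\<close>.
  As \<open>X\<^sub>i\<^sub>+\<^sub>1\<close> is invariant under \<open>H\<^sub>i\<close>,
  the product \<open>P(y) X\<^sub>i\<^sub>+\<^sub>1\<close> is the sum of \<open>P(y t')\<close> over all these transpositions \<open>t'\<close> (\<open>conj_sum_mult\<close>).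
  Order elements by the number of places in \<open>{1..i}\<close> where they act nontrivially, their degree.
  If \<open>y\<close> acts nontrivially at the place exchanged with \<open>i+1\<close> by \<open>t'\<close>, then \<open>y t'\<close>
  has degree at most that of \<open>y\<close>, which is less than that of \<open>x\<close>, and \<open>P(y t')\<close> is known to be in \<open>V\<close>;
  otherwise \<open>y t'\<close> is conjugate to \<open>x\<close> under \<open>H\<^sub>i\<close> and \<open>P(y t') = P(x)\<close> (\<open>conj_sum_mult_twist\<close>). So a
  positive multiple of \<open>P(x)\<close> is \<open>P(y) X\<^sub>i\<^sub>+\<^sub>1\<close> minus elements of \<open>V\<close>, and induction on the degree
  finishes the proof. Working with \<open>P(x)\<close>, rather than with sums over orbits, makes any
  classification of orbits by marked cycle types unnecessary.
\<close>

section \<open>The group algebra of a finite group\<close>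

lemma group_algebra_simps:
  "carrier (group_algebra K) = {a. \<forall>x. x \<notin> carrier K \<longrightarrow> a x = 0}"
  "a \<oplus>\<^bsub>group_algebra K\<^esub> b = (\<lambda>x. a x + b x)"
  "c \<odot>\<^bsub>group_algebra K\<^esub> a = (\<lambda>x. c * a x)"
  "\<zero>\<^bsub>group_algebra K\<^esub> = (\<lambda>x. 0)"
  by (simp_all add: group_algebra_def)

lemma abelian_monoid_group_algebra: "abelian_monoid (group_algebra K)"
  by (rule abelian_monoidI) (auto simp: group_algebra_simps add.assoc add.commute)

lemma finsum_group_algebra:
  assumes "finite I" and "\<And>i. i \<in> I \<Longrightarrow> f i \<in> carrier (group_algebra K)"
  shows "(\<Oplus>\<^bsub>group_algebra K\<^esub> i\<in>I. f i) = (\<lambda>x. \<Sum>i\<in>I. f i x)"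
proof -
  interpret abelian_monoid "group_algebra K" by (rule abelian_monoid_group_algebra)
  show ?thesis using assms
  proof (induction I rule: finite_induct)
    case (insert i I)
    then show ?case
      by (subst finsum_insert) (auto simp: group_algebra_simps)
  qed (simp add: group_algebra_simps)
qed

lemma unital_subalgebra_closed:
  assumes "unital_subalgebra V (group_algebra K)"
  shows "a \<in> V \<Longrightarrow> b \<in> V \<Longrightarrow> (\<lambda>x. a x + b x) \<in> V"
    and "a \<in> V \<Longrightarrow> (\<lambda>x. c * a x) \<in> V"
    and "a \<in> V \<Longrightarrow> b \<in> V \<Longrightarrow> a \<otimes>\<^bsub>group_algebra K\<^esub> b \<in> V"
    and "a \<in> V \<Longrightarrow> b \<in> V \<Longrightarrow> (\<lambda>x. a x - b x) \<in> V"
    and "(\<lambda>x. c * a x) \<in> V \<Longrightarrow> c \<noteq> 0 \<Longrightarrow> a \<in> V"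
    and "finite I \<Longrightarrow> (\<And>i. i \<in> I \<Longrightarrow> f i \<in> V) \<Longrightarrow> (\<lambda>x. \<Sum>i\<in>I. f i x) \<in> V"
proof -
  interpret subring V "group_algebra K"
    using assms by (simp add: unital_subalgebra_def)
  have add: "(\<lambda>x. a x + b x) \<in> V" if "a \<in> V" "b \<in> V" for a b
    using subgroup.m_closed[OF subring.axioms(1)[OF subring_axioms], of a b] that
    by (simp add: group_algebra_simps)
  show "a \<in> V \<Longrightarrow> b \<in> V \<Longrightarrow> (\<lambda>x. a x + b x) \<in> V" by (rule add)
  have smult: "(\<lambda>x. c * a x) \<in> V" if "a \<in> V" for a c
    using assms that by (force simp: unital_subalgebra_def group_algebra_simps)
  show "a \<in> V \<Longrightarrow> (\<lambda>x. c * a x) \<in> V" by (rule smult)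
  show "a \<in> V \<Longrightarrow> b \<in> V \<Longrightarrow> a \<otimes>\<^bsub>group_algebra K\<^esub> b \<in> V" by simp
  show "(\<lambda>x. a x - b x) \<in> V" if "a \<in> V" "b \<in> V"
    using add[OF that(1) smult[OF that(2), of "-1"]] by simp
  show "a \<in> V" if "(\<lambda>x. c * a x) \<in> V" "c \<noteq> 0"
    using smult[OF that(1), of "inverse c"] that(2) by (simp add: mult.assoc[symmetric])
  have zero: "(\<lambda>x. 0) \<in> V" using smult[OF one_closed, of 0] by simp
  show "(\<lambda>x. \<Sum>i\<in>I. f i x) \<in> V" if "finite I" "\<And>i. i \<in> I \<Longrightarrow> f i \<in> V"
    using that by (induction I rule: finite_induct) (auto simp: zero intro: add)
qed

context group
begin

lemma inv_mult_cancel: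
  assumes "x \<in> carrier G" "y \<in> carrier G"
  shows "inv x \<otimes> (x \<otimes> y) = y" and "x \<otimes> (inv x \<otimes> y) = y"
  using assms by (simp_all add: m_assoc[symmetric])

lemma conj_eq_iff:
  assumes "h \<in> carrier G" "x \<in> carrier G" "y \<in> carrier G"
  shows "h \<otimes> x \<otimes> inv h = y \<longleftrightarrow> x = inv h \<otimes> y \<otimes> h"
proof -
  have "h \<otimes> x \<otimes> inv h = y \<longleftrightarrow> h \<otimes> x = y \<otimes> h"
    by (rule inv_solve_right') (use assms in auto)
  also have "\<dots> \<longleftrightarrow> y \<otimes> h = h \<otimes> x" by (rule eq_commute)
  also have "\<dots> \<longleftrightarrow> x = inv h \<otimes> (y \<otimes> h)"
    by (rule inv_solve_left[symmetric]) (use assms in auto)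
  finally show ?thesis using assms by (simp add: m_assoc)
qed

lemma group_algebra_mult_eq:
  assumes "x \<in> carrier G"
  shows "(a \<otimes>\<^bsub>group_algebra G\<^esub> b) x = (\<Sum>y\<in>carrier G. a y * b (inv y \<otimes> x))"
    and "(a \<otimes>\<^bsub>group_algebra G\<^esub> b) x = (\<Sum>y\<in>carrier G. a (x \<otimes> inv y) * b y)"
proof -
  let ?S = "{(y, z). y \<in> carrier G \<and> z \<in> carrier G \<and> y \<otimes> z = x}"
  have *: "(a \<otimes>\<^bsub>group_algebra G\<^esub> b) x = (\<Sum>(y, z)\<in>?S. a y * b z)"
    by (simp add: group_algebra_def)
  show "(a \<otimes>\<^bsub>group_algebra G\<^esub> b) x = (\<Sum>y\<in>carrier G. a y * b (inv y \<otimes> x))"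
    unfolding * using assms
    by (intro sum.reindex_bij_witness[where j = fst and i = "\<lambda>y. (y, inv y \<otimes> x)"])
       (auto simp: inv_solve_left m_assoc[symmetric])
  show "(a \<otimes>\<^bsub>group_algebra G\<^esub> b) x = (\<Sum>y\<in>carrier G. a (x \<otimes> inv y) * b y)"
    unfolding * using assms
    by (intro sum.reindex_bij_witness[where j = snd and i = "\<lambda>y. (x \<otimes> inv y, y)"])
       (auto simp: inv_solve_right m_assoc)
qed

lemma group_algebra_mult_outside:
  "x \<notin> carrier G \<Longrightarrow> (a \<otimes>\<^bsub>group_algebra G\<^esub> b) x = 0"
  unfolding group_algebra_def by (auto intro!: sum.neutral)

text \<open>Commuting with the basis elements already forces a central element to be a class function;
  the form \<open>z (x \<otimes> y) = z (y \<otimes> x)\<close> mentions no inverses and so passes to subgroups unchanged.\<close>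

lemma center_group_algebra:
  assumes fin: "finite (carrier G)"
  shows "center (group_algebra G) =
    {z. (\<forall>x. x \<notin> carrier G \<longrightarrow> z x = 0) \<and>
        (\<forall>x\<in>carrier G. \<forall>y\<in>carrier G. z (x \<otimes> y) = z (y \<otimes> x))}" (is "_ = ?R")
proof (intro equalityI subsetI)
  fix z assume z: "z \<in> center (group_algebra G)"
  have "z (x \<otimes> y) = z (y \<otimes> x)" if xy: "x \<in> carrier G" "y \<in> carrier G" for x y
  proof -
    have b: "basis_elt y \<in> carrier (group_algebra G)"
      using xy by (auto simp: group_algebra_simps basis_elt_def)
    have "z (x \<otimes> y) = (basis_elt y \<otimes>\<^bsub>group_algebra G\<^esub> z) (y \<otimes> x \<otimes> y)"
      using xy fin
      by (subst group_algebra_mult_eq(1))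
         (auto simp: basis_elt_def if_distrib[of "\<lambda>c. c * _"] m_assoc inv_mult_cancel cong: if_cong)
    also have "\<dots> = (z \<otimes>\<^bsub>group_algebra G\<^esub> basis_elt y) (y \<otimes> x \<otimes> y)"
      using z b by (simp add: center_def)
    also have "\<dots> = z (y \<otimes> x)"
      using xy fin
      by (subst group_algebra_mult_eq(2))
         (auto simp: basis_elt_def if_distrib[of "\<lambda>c. _ * c"] m_assoc cong: if_cong)
    finally show ?thesis .
  qed
  then show "z \<in> ?R" using z by (auto simp: center_def group_algebra_simps)
next
  fix z assume z: "z \<in> ?R"
  have "(z \<otimes>\<^bsub>group_algebra G\<^esub> a) x = (a \<otimes>\<^bsub>group_algebra G\<^esub> z) x" for a x
  proof (cases "x \<in> carrier G")
    case True
    then show ?thesis using z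
      by (subst group_algebra_mult_eq(2), simp, subst group_algebra_mult_eq(1), simp)
         (auto intro!: sum.cong simp: mult.commute)
  qed (simp add: group_algebra_mult_outside)
  then show "z \<in> center (group_algebra G)"
    using z by (auto simp: center_def group_algebra_simps)
qed

lemma group_algebra_map_center:
  fixes L :: "('c, 'd) monoid_scheme"
  assumes L: "group L" and fin: "finite (carrier G)" and f: "f \<in> hom G L" "inj_on f (carrier G)"
  shows "group_algebra_map G f ` center (group_algebra G) =
    center (group_algebra (L\<lparr>carrier := f ` carrier G\<rparr>))"
proof -
  interpret L: group L by (rule L)
  interpret f: group_hom G L f by unfold_locales (rule f)
  let ?K = "L\<lparr>carrier := f ` carrier G\<rparr>"
  have K: "group ?K" by (rule subgroup.subgroup_is_group[OF f.img_is_subgroup L])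
  have map_f: "group_algebra_map G f a (f x) = a x" if "x \<in> carrier G" for a x
  proof -
    have "{y \<in> carrier G. f y = f x} = {x}" using that f(2) by (auto dest: inj_onD)
    then show ?thesis by (simp add: group_algebra_map_def)
  qed
  have map_out: "group_algebra_map G f a y = 0" if "y \<notin> f ` carrier G" for a y
    using that by (auto simp: group_algebra_map_def intro!: sum.neutral)
  note centers = center_group_algebra[OF fin] group.center_group_algebra[OF K, simplified, OF fin[THEN finite_imageI]]
  show ?thesis
  proof (intro equalityI subsetI)
    fix z assume "z \<in> group_algebra_map G f ` center (group_algebra G)"
    then obtain a where a: "a \<in> center (group_algebra G)" and z: "z = group_algebra_map G f a"
      by blast
    show "z \<in> center (group_algebra ?K)"
      unfolding centers z using a
      by (auto simp: centers map_out map_f simp flip: f.hom_mult)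
  next
    fix z assume z: "z \<in> center (group_algebra ?K)"
    define a where "a x = (if x \<in> carrier G then z (f x) else 0)" for x
    have "a \<in> center (group_algebra G)"
      using z unfolding centers by (auto simp: a_def)
    moreover have "z = group_algebra_map G f a"
    proof
      fix y show "z y = group_algebra_map G f a y"
        using z unfolding centers by (cases "y \<in> f ` carrier G") (auto simp: map_f map_out a_def)
    qed
    ultimately show "z \<in> group_algebra_map G f ` center (group_algebra G)" by blast
  qed
qed

section \<open>Sums over conjugates\<close>

definition conj_sum :: "'a set \<Rightarrow> 'a \<Rightarrow> 'a \<Rightarrow> complex"
  where "conj_sum H x y = (\<Sum>h\<in>H. of_bool (h \<otimes> x \<otimes> inv h = y))"

lemma conj_sum_outside:
  assumes "H \<subseteq> carrier G" "x \<in> carrier G" "y \<notin> carrier G"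
  shows "conj_sum H x y = 0"
  unfolding conj_sum_def using assms by (intro sum.neutral) auto

text \<open>Reindexing by right translation with \<open>g\<close>.\<close>

lemma conj_sum_conj:
  assumes H: "subgroup H G" and g: "g \<in> H" and xy: "x \<in> carrier G" "y \<in> carrier G"
    and conj: "g \<otimes> x = y \<otimes> g"
  shows "conj_sum H x = conj_sum H y"
proof
  fix z
  interpret H: subgroup H G by (rule H)
  have eq: "h \<otimes> x \<otimes> inv h = (h \<otimes> inv g) \<otimes> y \<otimes> inv (h \<otimes> inv g)" if "h \<in> H" for h
  proof -
    have c: "h \<in> carrier G" "g \<in> carrier G" using that g by auto
    have "(h \<otimes> inv g) \<otimes> y \<otimes> inv (h \<otimes> inv g) = h \<otimes> inv g \<otimes> (y \<otimes> g) \<otimes> inv h"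
      using c xy by (simp add: m_assoc inv_mult_group)
    also have "\<dots> = h \<otimes> x \<otimes> inv h"
      unfolding conj[symmetric] using c xy by (simp add: m_assoc inv_mult_cancel)
    finally show ?thesis by simp
  qed
  show "conj_sum H x z = conj_sum H y z"
    unfolding conj_sum_def
    by (rule sum.reindex_bij_witness[where j = "\<lambda>h. h \<otimes> inv g" and i = "\<lambda>h. h \<otimes> g"])
       (use g eq H.subset in \<open>auto simp: m_assoc subset_iff\<close>)
qed

lemma indicator_in_center:
  assumes H: "subgroup H G" and fin: "finite (carrier G)"
    and T: "T \<subseteq> H" "\<And>h t. h \<in> H \<Longrightarrow> t \<in> T \<Longrightarrow> h \<otimes> t \<otimes> inv h \<in> T"
  shows "(\<lambda>x. of_bool (x \<in> T)) \<in> center (group_algebra (G\<lparr>carrier := H\<rparr>))"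
proof -
  interpret H: subgroup H G by (rule H)
  have K: "group (G\<lparr>carrier := H\<rparr>)" by (rule H.subgroup_is_group) (rule is_group)
  have rotate: "w \<otimes> y \<in> T" if "y \<otimes> w \<in> T" "y \<in> H" "w \<in> H" for y w
    using T(2)[OF that(3,1)] that(2,3) by (simp add: m_assoc)
  have "y \<otimes> w \<in> T \<longleftrightarrow> w \<otimes> y \<in> T" if "y \<in> H" "w \<in> H" for y w
    using rotate that by blast
  then show ?thesis
    using group.center_group_algebra[OF K] finite_subset[OF H.subset fin] T(1) by auto
qed

text \<open>Reindexing by left translation conjugates the value at which the sum is evaluated.\<close>

lemma conj_sum_in_center:
  assumes H: "subgroup H G" and fin: "finite (carrier G)" and x: "x \<in> H"
  shows "conj_sum H x \<in> center (group_algebra (G\<lparr>carrier := H\<rparr>))"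
proof -
  interpret H: subgroup H G by (rule H)
  have K: "group (G\<lparr>carrier := H\<rparr>)" by (rule H.subgroup_is_group) (rule is_group)
  have outside: "conj_sum H x y = 0" if "y \<notin> H" for y
    unfolding conj_sum_def using that x by (intro sum.neutral) auto
  have comm: "conj_sum H x (y \<otimes> w) = conj_sum H x (w \<otimes> y)" if yw: "y \<in> H" "w \<in> H" for y w
  proof -
    have eq: "w \<otimes> h \<otimes> x \<otimes> inv (w \<otimes> h) = w \<otimes> y \<longleftrightarrow> h \<otimes> x \<otimes> inv h = y \<otimes> w" if "h \<in> H" for h
    proof -
      have c: "h \<in> carrier G" "w \<in> carrier G" "y \<in> carrier G" "x \<in> carrier G"
        using that yw x by auto
      have "w \<otimes> h \<otimes> x \<otimes> inv (w \<otimes> h) = w \<otimes> (h \<otimes> x \<otimes> inv h \<otimes> inv w)"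
        using c by (simp add: m_assoc inv_mult_group)
      also have "\<dots> = w \<otimes> y \<longleftrightarrow> h \<otimes> x \<otimes> inv h \<otimes> inv w = y"
        using c by simp
      also have "\<dots> \<longleftrightarrow> h \<otimes> x \<otimes> inv h = y \<otimes> w"
        using c inv_solve_right'[of y "h \<otimes> x \<otimes> inv h" w] by auto
      finally show ?thesis .
    qed
    show ?thesis
      unfolding conj_sum_def
      by (rule sum.reindex_bij_witness[where j = "\<lambda>h. w \<otimes> h" and i = "\<lambda>h. inv w \<otimes> h"])
         (use yw H.subset eq in \<open>auto simp: inv_mult_cancel subset_iff\<close>)
  qed
  show ?thesis
    using group.center_group_algebra[OF K] finite_subset[OF H.subset fin] outside comm by simp
qed

text \<open>A coefficient function that is invariant under \<open>H\<close> equals its own average over \<open>H\<close>; expanding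
  it in basis elements writes it, up to the factor \<open>card H\<close>, in terms of conjugate sums.\<close>

lemma conj_sum_average:
  assumes H: "subgroup H G" and L: "subgroup L G" "H \<subseteq> L" and fin: "finite (carrier G)"
    and outside: "\<And>x. x \<notin> L \<Longrightarrow> a x = 0"
    and comm: "\<And>h x. h \<in> H \<Longrightarrow> x \<in> L \<Longrightarrow> a (h \<otimes> x) = a (x \<otimes> h)"
  shows "(\<Sum>x\<in>L. a x * conj_sum H x y) = of_nat (card H) * a y"
proof -
  interpret H: subgroup H G by (rule H)
  interpret L: subgroup L G by (rule L)
  have finL: "finite L" using finite_subset[OF L.subset fin] .
  have inner: "(\<Sum>x\<in>L. a x * of_bool (h \<otimes> x \<otimes> inv h = y)) = a y" if h: "h \<in> H" for h
  proof (cases "y \<in> L")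
    case True
    have hL: "h \<in> L" using h L by auto
    have eq: "h \<otimes> x \<otimes> inv h = y \<longleftrightarrow> x = inv h \<otimes> y \<otimes> h" if "x \<in> L" for x
      by (rule conj_eq_iff) (use hL True that in auto)
    have "(\<Sum>x\<in>L. a x * of_bool (h \<otimes> x \<otimes> inv h = y)) = (\<Sum>x\<in>L. if x = inv h \<otimes> y \<otimes> h then a x else 0)"
      by (intro sum.cong) (auto simp: eq)
    also have "\<dots> = a (inv h \<otimes> y \<otimes> h)"
      using hL True finL by simp
    also have "\<dots> = a (h \<otimes> (inv h \<otimes> y))"
      using comm[OF h, of "inv h \<otimes> y"] hL True by simp
    also have "\<dots> = a y" using hL True by (simp add: inv_mult_cancel)
    finally show ?thesis .
  next
    case False
    then have "h \<otimes> x \<otimes> inv h \<noteq> y" if "x \<in> L" for x using that h L by auto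
    then show ?thesis using False outside by simp
  qed
  have "(\<Sum>x\<in>L. a x * conj_sum H x y) = (\<Sum>h\<in>H. \<Sum>x\<in>L. a x * of_bool (h \<otimes> x \<otimes> inv h = y))"
    unfolding conj_sum_def sum_distrib_left by (rule sum.swap)
  then show ?thesis using inner by simp
qed

text \<open>An \<open>H\<close>-invariant sum over \<open>T\<close> can be moved inside the conjugation: as \<open>t\<close> runs through \<open>T\<close>, so
  does \<open>h \<otimes> t \<otimes> inv h\<close>, and \<open>(h \<otimes> x \<otimes> inv h) \<otimes> (h \<otimes> t \<otimes> inv h)\<close> is the conjugate of \<open>x \<otimes> t\<close>.\<close>

lemma conj_sum_mult:
  assumes H: "subgroup H G" and fin: "finite (carrier G)" and x: "x \<in> carrier G"
    and T: "T \<subseteq> carrier G" "\<And>h t. h \<in> H \<Longrightarrow> t \<in> T \<Longrightarrow> h \<otimes> t \<otimes> inv h \<in> T"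
  shows "conj_sum H x \<otimes>\<^bsub>group_algebra G\<^esub> (\<lambda>y. of_bool (y \<in> T)) = (\<lambda>y. \<Sum>t\<in>T. conj_sum H (x \<otimes> t) y)"
proof
  interpret H: subgroup H G by (rule H)
  fix y
  show "(conj_sum H x \<otimes>\<^bsub>group_algebra G\<^esub> (\<lambda>y. of_bool (y \<in> T))) y = (\<Sum>t\<in>T. conj_sum H (x \<otimes> t) y)"
  proof (cases "y \<in> carrier G")
    case False
    have "conj_sum H (x \<otimes> t) y = 0" if "t \<in> T" for t
      using conj_sum_outside[OF H.subset _ False] x T(1) that by auto
    then show ?thesis using False by (simp add: group_algebra_mult_outside)
  next
    case y: True
    let ?c = "\<lambda>h. h \<otimes> x \<otimes> inv h"
    let ?t = "\<lambda>h. inv x \<otimes> (inv h \<otimes> y \<otimes> h)"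
    have finT: "finite T" using finite_subset[OF T(1) fin] .
    have conj_t: "h \<otimes> ?t h \<otimes> inv h = inv (?c h) \<otimes> y" if "h \<in> H" for h
    proof -
      have c: "h \<in> carrier G" using that by auto
      show ?thesis using c x y by (simp add: m_assoc inv_mult_group inv_mult_cancel)
    qed
    have mem: "inv (?c h) \<otimes> y \<in> T \<longleftrightarrow> ?t h \<in> T" if h: "h \<in> H" for h
    proof
      assume "?t h \<in> T"
      then show "inv (?c h) \<otimes> y \<in> T" using T(2)[OF h] conj_t[OF h] by metis
    next
      assume "inv (?c h) \<otimes> y \<in> T"
      then have "inv h \<otimes> (h \<otimes> ?t h \<otimes> inv h) \<otimes> inv (inv h) \<in> T"
        using T(2)[of "inv h"] conj_t[OF h] h by auto
      moreover have "inv h \<otimes> (h \<otimes> ?t h \<otimes> inv h) \<otimes> inv (inv h) = ?t h"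
        using H.subset h x y by (simp add: m_assoc inv_mult_cancel subset_iff)
      ultimately show "?t h \<in> T" by simp
    qed
    have solve: "h \<otimes> (x \<otimes> t) \<otimes> inv h = y \<longleftrightarrow> t = ?t h" if "h \<in> H" "t \<in> T" for h t
    proof -
      have c: "h \<in> carrier G" "t \<in> carrier G" using that T by auto
      have "h \<otimes> (x \<otimes> t) \<otimes> inv h = y \<longleftrightarrow> inv h \<otimes> y \<otimes> h = x \<otimes> t"
        unfolding eq_commute[of "inv h \<otimes> y \<otimes> h"] by (rule conj_eq_iff) (use c x y in auto)
      also have "\<dots> \<longleftrightarrow> t = ?t h"
        by (rule inv_solve_left[symmetric]) (use c x y in auto)
      finally show ?thesis .
    qed
    have "(conj_sum H x \<otimes>\<^bsub>group_algebra G\<^esub> (\<lambda>y. of_bool (y \<in> T))) y =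
        (\<Sum>h\<in>H. \<Sum>z\<in>carrier G. of_bool (?c h = z) * of_bool (inv z \<otimes> y \<in> T))"
      unfolding group_algebra_mult_eq(1)[OF y] conj_sum_def sum_distrib_right by (rule sum.swap)
    also have "\<dots> = (\<Sum>h\<in>H. of_bool (?t h \<in> T))"
    proof (intro sum.cong refl)
      fix h assume h: "h \<in> H"
      have "(\<Sum>z\<in>carrier G. of_bool (?c h = z) * of_bool (inv z \<otimes> y \<in> T)) =
          (\<Sum>z\<in>carrier G. if ?c h = z then of_bool (inv z \<otimes> y \<in> T) else (0::complex))"
        by (intro sum.cong) auto
      also have "\<dots> = of_bool (?t h \<in> T)"
        using H.subset h fin x mem[OF h] by (simp add: subset_iff)
      finally show "(\<Sum>z\<in>carrier G. of_bool (?c h = z) * of_bool (inv z \<otimes> y \<in> T)) =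
          (of_bool (?t h \<in> T) :: complex)" .
    qed
    also have "\<dots> = (\<Sum>h\<in>H. \<Sum>t\<in>T. of_bool (h \<otimes> (x \<otimes> t) \<otimes> inv h = y))"
    proof (intro sum.cong refl)
      fix h assume h: "h \<in> H"
      have "(\<Sum>t\<in>T. of_bool (h \<otimes> (x \<otimes> t) \<otimes> inv h = y)) = (\<Sum>t\<in>T. if t = ?t h then 1 else (0::complex))"
        by (intro sum.cong) (auto simp: solve h)
      then show "of_bool (?t h \<in> T) = (\<Sum>t\<in>T. of_bool (h \<otimes> (x \<otimes> t) \<otimes> inv h = y) :: complex)"
        using finT by simp
    qed
    also have "\<dots> = (\<Sum>t\<in>T. conj_sum H (x \<otimes> t) y)"
      unfolding conj_sum_def by (rule sum.swap)
    finally show ?thesis .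
  qed
qed

end

section \<open>The wreath product\<close>

lemma wreath_carrier:
  "(f, p) \<in> carrier (wreath G n) \<longleftrightarrow> f \<in> {1..n} \<rightarrow>\<^sub>E carrier G \<and> p permutes {1..n}"
  by (simp add: wreath_def sym_group_def)

lemma wreath_mult:
  "(f, p) \<otimes>\<^bsub>wreath G n\<^esub> (h, q) =
    ((\<lambda>i\<in>{1..n}. f i \<otimes>\<^bsub>G\<^esub> h (Hilbert_Choice.inv p i)), p \<circ> q)"
  by (simp add: wreath_def)

lemma wreath_one: "\<one>\<^bsub>wreath G n\<^esub> = ((\<lambda>i\<in>{1..n}. \<one>\<^bsub>G\<^esub>), id)"
  by (simp add: wreath_def)

lemma permutes_inv_in:
  assumes "p permutes S"
  shows "Hilbert_Choice.inv p i \<in> S \<longleftrightarrow> i \<in> S"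
  using permutes_in_image[OF permutes_inv[OF assms]] .

context group
begin

lemma wreath_group: "group (wreath G n)"
proof (rule groupI)
  show "\<one>\<^bsub>wreath G n\<^esub> \<in> carrier (wreath G n)"
    by (auto simp: wreath_one wreath_carrier permutes_id)
next
  fix x y assume "x \<in> carrier (wreath G n)" "y \<in> carrier (wreath G n)"
  then show "x \<otimes>\<^bsub>wreath G n\<^esub> y \<in> carrier (wreath G n)"
    by (cases x; cases y) (auto simp: wreath_mult wreath_carrier PiE_iff permutes_inv_in permutes_compose
        simp del: atLeastAtMost_iff)
next
  fix x y z assume "x \<in> carrier (wreath G n)" "y \<in> carrier (wreath G n)" "z \<in> carrier (wreath G n)"
  then show "x \<otimes>\<^bsub>wreath G n\<^esub> y \<otimes>\<^bsub>wreath G n\<^esub> z = x \<otimes>\<^bsub>wreath G n\<^esub> (y \<otimes>\<^bsub>wreath G n\<^esub> z)"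
    by (cases x; cases y; cases z)
       (auto simp: wreath_mult wreath_carrier PiE_iff permutes_inv_in m_assoc comp_assoc
         o_inv_distrib permutes_bij simp del: atLeastAtMost_iff intro!: restrict_ext)
next
  fix x assume "x \<in> carrier (wreath G n)"
  then show "\<one>\<^bsub>wreath G n\<^esub> \<otimes>\<^bsub>wreath G n\<^esub> x = x"
    by (cases x) (auto simp: wreath_one wreath_mult wreath_carrier PiE_iff extensional_def)
next
  fix x assume "x \<in> carrier (wreath G n)"
  then obtain f p where x: "x = (f, p)" "f \<in> {1..n} \<rightarrow>\<^sub>E carrier G" "p permutes {1..n}"
    by (cases x) (auto simp: wreath_carrier)
  let ?q = "Hilbert_Choice.inv p"
  have "((\<lambda>i\<in>{1..n}. inv f (p i)), ?q) \<in> carrier (wreath G n)"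
    using x by (auto simp: wreath_carrier permutes_inv permutes_in_image PiE_iff
      simp del: atLeastAtMost_iff)
  moreover have "((\<lambda>i\<in>{1..n}. inv f (p i)), ?q) \<otimes>\<^bsub>wreath G n\<^esub> x = \<one>\<^bsub>wreath G n\<^esub>"
    using x by (auto simp: wreath_mult wreath_one permutes_inv_o permutes_inv_inv permutes_in_image PiE_iff
      simp del: atLeastAtMost_iff intro!: restrict_ext)
  ultimately show "\<exists>y\<in>carrier (wreath G n). y \<otimes>\<^bsub>wreath G n\<^esub> x = \<one>\<^bsub>wreath G n\<^esub>" by blast
qed

lemma finite_wreath: "finite (carrier G) \<Longrightarrow> finite (carrier (wreath G n))"
  by (simp add: wreath_def sym_group_def finite_PiE finite_permutations)

lemma wreath_subgroup_iff:
  "(f, p) \<in> wreath_subgroup G i n \<longleftrightarrow>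
    (f, p) \<in> carrier (wreath G n) \<and> (\<forall>j\<in>{i + 1..n}. p j = j)"
  by (auto simp: wreath_subgroup_def)

lemma subgroup_wreath_subgroup:
  shows "subgroup (wreath_subgroup G i n) (wreath G n)"
proof -
  interpret W: group "wreath G n" by (rule wreath_group)
  show ?thesis
  proof (rule W.subgroupI)
    show "wreath_subgroup G i n \<subseteq> carrier (wreath G n)" by (auto simp: wreath_subgroup_def)
    show "wreath_subgroup G i n \<noteq> {}"
      using W.one_closed by (force simp: wreath_subgroup_def wreath_one)
    show "x \<otimes>\<^bsub>wreath G n\<^esub> y \<in> wreath_subgroup G i n"
      if "x \<in> wreath_subgroup G i n" "y \<in> wreath_subgroup G i n" for x y
      using that W.m_closed[of x y]
      by (cases x; cases y) (auto simp: wreath_subgroup_iff wreath_mult)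
    show "inv\<^bsub>wreath G n\<^esub> x \<in> wreath_subgroup G i n" if x: "x \<in> wreath_subgroup G i n" for x
    proof -
      obtain f p h q where eqs: "x = (f, p)" "inv\<^bsub>wreath G n\<^esub> x = (h, q)" by (metis surj_pair)
      have p: "(f, p) \<in> carrier (wreath G n)" "\<forall>j\<in>{i + 1..n}. p j = j"
        using x eqs by (auto simp: wreath_subgroup_iff)
      have "(f, p) \<otimes>\<^bsub>wreath G n\<^esub> (h, q) = \<one>\<^bsub>wreath G n\<^esub>"
        using W.r_inv[of x] p(1) eqs by metis
      then have "p \<circ> q = id" by (simp add: wreath_mult wreath_one)
      moreover have "inj p" using p by (auto simp: wreath_carrier permutes_inj)
      ultimately have "q j = j" if "p j = j" for j
        using that by (metis comp_apply id_apply injD)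
      moreover have "(h, q) \<in> carrier (wreath G n)"
        using W.inv_closed[of x] p(1) eqs by metis
      ultimately show ?thesis
        using p(2) by (simp add: eqs(2) wreath_subgroup_iff)
    qed
  qed
qed

lemma wreath_subgroup_permutes:
  assumes "(f, p) \<in> wreath_subgroup G i n"
  shows "p permutes {1..i}"
proof (rule permutes_superset)
  show "p permutes {1..n}" using assms by (simp add: wreath_subgroup_iff wreath_carrier)
qed (use assms in \<open>auto simp: wreath_subgroup_iff\<close>)

lemma wreath_subgroup_mono: "i \<le> j \<Longrightarrow> wreath_subgroup G i n \<subseteq> wreath_subgroup G j n"
  by (auto simp: wreath_subgroup_def)

section \<open>Twisted transpositions\<close>

text \<open>For \<open>k \<noteq> j\<close> this is the product \<open>(g\<inverse>)\<^sup>(\<^sup>k\<^sup>) g\<^sup>(\<^sup>j\<^sup>) (k,j)\<close>; see \<open>twist_eq_product\<close>.\<close>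

definition twist :: "nat \<Rightarrow> nat \<Rightarrow> nat \<Rightarrow> 'a \<Rightarrow> (nat \<Rightarrow> 'a) \<times> (nat \<Rightarrow> nat)"
  where "twist n k j g =
    ((\<lambda>l\<in>{1..n}. if l = k then inv g else if l = j then g else \<one>), transpose k j)"

lemma twist_closed:
  assumes "k \<in> {1..n}" "j \<in> {1..n}" "g \<in> carrier G"
  shows "twist n k j g \<in> carrier (wreath G n)"
  using assms permutes_swap_id[of k "{1..n}" j] by (auto simp: twist_def wreath_carrier)

lemma twist_eq_product:
  assumes "k \<in> {1..n}" "j \<in> {1..n}" "k \<noteq> j" "g \<in> carrier G"
  shows "coord_elt G n k (inv g) \<otimes>\<^bsub>wreath G n\<^esub> coord_elt G n j g \<otimes>\<^bsub>wreath G n\<^esub>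
    perm_elt G n (transpose k j) = twist n k j g"
  using assms by (auto simp: coord_elt_def perm_elt_def twist_def wreath_mult intro!: restrict_ext)

lemma twist_flip:
  assumes "k \<noteq> j" "g \<in> carrier G"
  shows "twist n k j g = twist n j k (inv g)"
  using assms by (auto simp: twist_def transpose_commute intro!: restrict_ext)

text \<open>Conjugation permutes the twisted transpositions; stating it without an inverse of \<open>(a, p)\<close>
  avoids a formula for inverses in the wreath product.\<close>

lemma twist_conj:
  assumes x: "(a, p) \<in> carrier (wreath G n)"
    and kj: "k \<in> {1..n}" "j \<in> {1..n}" "k \<noteq> j" and g: "g \<in> carrier G"
  shows "(a, p) \<otimes>\<^bsub>wreath G n\<^esub> twist n k j g =
    twist n (p k) (p j) (a (p j) \<otimes> g \<otimes> inv a (p k)) \<otimes>\<^bsub>wreath G n\<^esub> (a, p)"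
proof -
  have p: "p permutes {1..n}" and a: "\<And>l. l \<in> {1..n} \<Longrightarrow> a l \<in> carrier G"
    using x by (auto simp: wreath_carrier)
  have inj: "p u = p v \<longleftrightarrow> u = v" for u v using permutes_inj[OF p] by (auto dest: injD)
  have pl: "p l \<in> {1..n}" if "l \<in> {1..n}" for l using that permutes_in_image[OF p] by blast
  have ak: "a (p k) \<in> carrier G" "a (p j) \<in> carrier G" using a pl kj by blast+
  have perms: "p \<circ> transpose k j = transpose (p k) (p j) \<circ> p"
    by (auto simp: fun_eq_iff transpose_def inj)
  show ?thesis
    unfolding twist_def wreath_mult perms
  proof (intro arg_cong2[where f = Pair] restrict_ext refl)
    fix l assume "l \<in> {1..n}"
    define l' where "l' = Hilbert_Choice.inv p l"
    have l: "l = p l'" "l' \<in> {1..n}"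
      using \<open>l \<in> {1..n}\<close> permutes_inv_in[OF p] permutes_inverses[OF p] by (auto simp: l'_def)
    have li: "Hilbert_Choice.inv p (p l') = l'" using permutes_inverses[OF p] by auto
    show "a l \<otimes> (\<lambda>l\<in>{1..n}. if l = k then inv g else if l = j then g else \<one>) (Hilbert_Choice.inv p l) =
      (\<lambda>l\<in>{1..n}. if l = p k then inv (a (p j) \<otimes> g \<otimes> inv a (p k))
        else if l = p j then a (p j) \<otimes> g \<otimes> inv a (p k) else \<one>) l \<otimes>
      a (Hilbert_Choice.inv (transpose (p k) (p j)) l)"
      unfolding l(1) li using l(2) kj(3) g ak pl[OF l(2)] a[OF pl[OF l(2)]]
      by (auto simp: inj m_assoc inv_mult_group simp del: atLeastAtMost_iff)
  qed
qed

lemma twist_twist: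
  assumes "k \<in> {1..n}" "j \<in> {1..n}" "k \<noteq> j" "g \<in> carrier G"
  shows "twist n k j g \<otimes>\<^bsub>wreath G n\<^esub> twist n k j g = \<one>\<^bsub>wreath G n\<^esub>"
  using assms by (auto simp: twist_def wreath_mult wreath_one transpose_def intro!: restrict_ext)

definition twists_to :: "nat \<Rightarrow> nat \<Rightarrow> ((nat \<Rightarrow> 'a) \<times> (nat \<Rightarrow> nat)) set"
  where "twists_to n i = {twist n k i g | k g. k \<in> {1..<i} \<and> g \<in> carrier G}"

text \<open>Each twisted transposition occurs here for both orders of its two places, by \<open>twist_flip\<close>; this
  makes closure under conjugation immediate, as conjugation does not respect the order.\<close>

definition twists_upto :: "nat \<Rightarrow> nat \<Rightarrow> ((nat \<Rightarrow> 'a) \<times> (nat \<Rightarrow> nat)) set"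
  where "twists_upto n i =
    {twist n k j g | k j g. k \<in> {1..i} \<and> j \<in> {1..i} \<and> k \<noteq> j \<and> g \<in> carrier G}"

text \<open>The summands of the double sum are pairwise distinct, so the sum has coefficients 0 and 1.\<close>

lemma YJM_eq:
  assumes fin: "finite (carrier G)" and i: "i \<le> n"
  shows "YJM G n i = (\<lambda>x. of_bool (x \<in> twists_to n i))"
proof
  fix x
  let ?A = "group_algebra (wreath G n)"
  let ?I = "{1..<i} \<times> carrier G"
  let ?e = "\<lambda>k g. basis_elt (coord_elt G n k (inv g) \<otimes>\<^bsub>wreath G n\<^esub> coord_elt G n i g
    \<otimes>\<^bsub>wreath G n\<^esub> perm_elt G n (transpose k i))"
  have e: "?e k g = basis_elt (twist n k i g)" if "k \<in> {1..<i}" "g \<in> carrier G" for k g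
    using that i by (subst twist_eq_product) auto
  have closed: "?e k g \<in> carrier ?A" if "k \<in> {1..<i}" "g \<in> carrier G" for k g
    unfolding e[OF that] using that i twist_closed[of k n i g]
    by (auto simp: basis_elt_def group_algebra_simps)
  have inner: "(\<Oplus>\<^bsub>?A\<^esub> g\<in>carrier G. ?e k g) = (\<lambda>x. \<Sum>g\<in>carrier G. basis_elt (twist n k i g) x)"
    if "k \<in> {1..<i}" for k
    using that closed fin by (subst finsum_group_algebra) (auto simp: e)
  have inj: "inj_on (\<lambda>(k, g). twist n k i g) ?I"
  proof (rule inj_onI, clarify)
    fix k g k' g'
    assume k: "k \<in> {1..<i}" "k' \<in> {1..<i}" and eq: "twist n k i g = twist n k' i g'"
    have "fst (twist n k i g) i = fst (twist n k' i g') i"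
      "snd (twist n k i g) i = snd (twist n k' i g') i" by (simp_all only: eq)
    then show "k = k' \<and> g = g'" using k i by (auto simp: twist_def)
  qed
  have twists: "twists_to n i = (\<lambda>(k, g). twist n k i g) ` ?I"
    by (force simp: twists_to_def)
  have finT: "finite (twists_to n i)" unfolding twists using fin by auto
  have "YJM G n i = (\<Oplus>\<^bsub>?A\<^esub> k\<in>{1..<i}. \<Oplus>\<^bsub>?A\<^esub> g\<in>carrier G. ?e k g)"
    by (simp add: YJM_def)
  also have "\<dots> = (\<lambda>x. \<Sum>k\<in>{1..<i}. (\<Oplus>\<^bsub>?A\<^esub> g\<in>carrier G. ?e k g) x)"
  proof (rule finsum_group_algebra)
    interpret abelian_monoid ?A by (rule abelian_monoid_group_algebra)
    show "(\<Oplus>\<^bsub>?A\<^esub> g\<in>carrier G. ?e k g) \<in> carrier ?A" if "k \<in> {1..<i}" for k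
      using closed[OF that] by (intro finsum_closed) auto
  qed simp
  finally have "YJM G n i x = (\<Sum>k\<in>{1..<i}. (\<Oplus>\<^bsub>?A\<^esub> g\<in>carrier G. ?e k g) x)"
    by simp
  also have "\<dots> = (\<Sum>k\<in>{1..<i}. \<Sum>g\<in>carrier G. basis_elt (twist n k i g) x)"
    using inner by simp
  also have "\<dots> = (\<Sum>t\<in>twists_to n i. basis_elt t x)"
    unfolding twists sum.reindex[OF inj] by (simp add: sum.cartesian_product case_prod_unfold)
  also have "\<dots> = of_bool (x \<in> twists_to n i)"
    using finT by (simp add: basis_elt_def)
  finally show "YJM G n i x = of_bool (x \<in> twists_to n i)" .
qed

lemma twists_to_closed: "i \<le> n \<Longrightarrow> twists_to n i \<subseteq> carrier (wreath G n)"
  using twist_closed by (fastforce simp: twists_to_def)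

lemma twists_to_conj:
  assumes i: "Suc i \<le> n" and h: "h \<in> wreath_subgroup G i n" and t: "t \<in> twists_to n (Suc i)"
  shows "h \<otimes>\<^bsub>wreath G n\<^esub> t \<otimes>\<^bsub>wreath G n\<^esub> inv\<^bsub>wreath G n\<^esub> h \<in> twists_to n (Suc i)"
proof -
  interpret W: group "wreath G n" by (rule wreath_group)
  obtain a p where h': "h = (a, p)" by (cases h)
  obtain k g where t': "t = twist n k (Suc i) g" "k \<in> {1..i}" "g \<in> carrier G"
    using t by (auto simp: twists_to_def)
  have hc: "(a, p) \<in> carrier (wreath G n)" and fixed: "p (Suc i) = Suc i"
    using h i by (auto simp: h' wreath_subgroup_iff)
  have pk: "p k \<in> {1..i}"
    using permutes_in_image[OF wreath_subgroup_permutes] h t'(2) unfolding h' by blast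
  let ?g = "a (p (Suc i)) \<otimes> g \<otimes> inv a (p k)"
  have g: "?g \<in> carrier G" using hc pk i t'(3) fixed by (auto simp: wreath_carrier PiE_iff)
  have "h \<otimes>\<^bsub>wreath G n\<^esub> t = twist n (p k) (Suc i) ?g \<otimes>\<^bsub>wreath G n\<^esub> h"
    unfolding h' t'(1) using t' i hc fixed by (subst twist_conj) auto
  moreover have "twist n (p k) (Suc i) ?g \<in> twists_to n (Suc i)"
    using pk g unfolding twists_to_def by force
  ultimately show ?thesis
    using hc h' subsetD[OF twists_to_closed[OF i]] by (simp add: W.m_assoc)
qed

lemma twists_upto_subset: "i \<le> n \<Longrightarrow> twists_upto n i \<subseteq> wreath_subgroup G i n"
proof
  fix t assume i: "i \<le> n" and "t \<in> twists_upto n i"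
  then obtain k j g where t: "t = twist n k j g" "k \<in> {1..i}" "j \<in> {1..i}" "g \<in> carrier G"
    by (auto simp: twists_upto_def)
  then show "t \<in> wreath_subgroup G i n"
    using twist_closed[of k n j g] i by (auto simp: twist_def wreath_subgroup_iff)
qed

lemma twists_upto_conj:
  assumes i: "i \<le> n" and h: "h \<in> wreath_subgroup G i n" and t: "t \<in> twists_upto n i"
  shows "h \<otimes>\<^bsub>wreath G n\<^esub> t \<otimes>\<^bsub>wreath G n\<^esub> inv\<^bsub>wreath G n\<^esub> h \<in> twists_upto n i"
proof -
  interpret W: group "wreath G n" by (rule wreath_group)
  obtain a p where h': "h = (a, p)" by (cases h)
  obtain k j g where t': "t = twist n k j g" "k \<in> {1..i}" "j \<in> {1..i}" "k \<noteq> j" "g \<in> carrier G"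
    using t by (auto simp: twists_upto_def)
  have hc: "(a, p) \<in> carrier (wreath G n)" using h by (auto simp: h' wreath_subgroup_iff)
  have p: "p permutes {1..i}" using h wreath_subgroup_permutes unfolding h' by blast
  have pk: "p k \<in> {1..i}" "p j \<in> {1..i}" "p k \<noteq> p j"
    using permutes_in_image[OF p] t' permutes_inj[OF p] by (auto dest: injD)
  let ?g = "a (p j) \<otimes> g \<otimes> inv a (p k)"
  have g: "?g \<in> carrier G" using hc pk i t' by (auto simp: wreath_carrier PiE_iff)
  have "h \<otimes>\<^bsub>wreath G n\<^esub> t = twist n (p k) (p j) ?g \<otimes>\<^bsub>wreath G n\<^esub> h"
    unfolding h' t'(1) using t' i hc by (subst twist_conj) auto
  moreover have "twist n (p k) (p j) ?g \<in> twists_upto n i"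
    using pk g unfolding twists_upto_def by blast
  moreover have "twist n (p k) (p j) ?g \<in> carrier (wreath G n)"
    using pk g i by (intro twist_closed) auto
  ultimately show ?thesis
    using hc h' by (simp add: W.m_assoc)
qed

lemma twists_upto_Suc: "twists_upto n (Suc i) = twists_upto n i \<union> twists_to n (Suc i)"
proof (intro equalityI subsetI)
  fix t assume "t \<in> twists_upto n (Suc i)"
  then obtain k j g where t: "t = twist n k j g" "k \<in> {1..Suc i}" "j \<in> {1..Suc i}" "k \<noteq> j" "g \<in> carrier G"
    by (auto simp: twists_upto_def)
  consider "j = Suc i" "k \<in> {1..<Suc i}" | "k = Suc i" "j \<in> {1..<Suc i}" | "k \<in> {1..i}" "j \<in> {1..i}"
    using t by fastforce
  then show "t \<in> twists_upto n i \<union> twists_to n (Suc i)"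
  proof cases
    case 2
    have "t = twist n j (Suc i) (inv g)" using twist_flip t 2 by blast
    then show ?thesis using 2 t(5) by (auto simp: twists_to_def)
  qed (use t in \<open>auto simp: twists_to_def twists_upto_def\<close>)
qed (fastforce simp: twists_to_def twists_upto_def)

lemma twists_disjoint: "twists_upto n i \<inter> twists_to n (Suc i) = {}"
proof -
  have "snd t (Suc i) = Suc i" if "t \<in> twists_upto n i" for t
    using that by (auto simp: twists_upto_def twist_def)
  moreover have "snd t (Suc i) \<noteq> Suc i" if "t \<in> twists_to n (Suc i)" for t
    using that by (auto simp: twists_to_def twist_def)
  ultimately show ?thesis by blast
qed

section \<open>The degree of an element\<close>

definition trivial_at :: "(nat \<Rightarrow> 'a) \<times> (nat \<Rightarrow> nat) \<Rightarrow> nat \<Rightarrow> bool"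
  where "trivial_at x j \<longleftrightarrow> fst x j = \<one> \<and> snd x j = j"

definition degree :: "nat \<Rightarrow> (nat \<Rightarrow> 'a) \<times> (nat \<Rightarrow> nat) \<Rightarrow> nat"
  where "degree i x = card {j \<in> {1..i}. \<not> trivial_at x j}"

lemma trivial_at_mult:
  assumes "x \<in> carrier (wreath G n)" "j \<in> {1..n}" "trivial_at x j" "trivial_at y j"
  shows "trivial_at (x \<otimes>\<^bsub>wreath G n\<^esub> y) j"
proof -
  obtain f p h q where xy: "x = (f, p)" "y = (h, q)" by (metis surj_pair)
  have "p permutes {1..n}" using assms xy by (simp add: wreath_carrier)
  then have "Hilbert_Choice.inv p j = j"
    using assms(3) xy permutes_inv_eq by (fastforce simp: trivial_at_def)
  then show ?thesis using assms xy by (simp add: trivial_at_def wreath_mult)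
qed

lemma trivial_at_twist:
  "l \<in> {1..n} \<Longrightarrow> l \<noteq> k \<Longrightarrow> l \<noteq> j \<Longrightarrow> trivial_at (twist n k j g) l"
  by (simp add: trivial_at_def twist_def)

text \<open>A permutation maps the places that it moves to places that it moves, and there the other
  element is trivial.\<close>

lemma wreath_commute:
  assumes "x \<in> carrier (wreath G n)" "y \<in> carrier (wreath G n)"
    and "\<And>j. j \<in> {1..n} \<Longrightarrow> trivial_at x j \<or> trivial_at y j"
  shows "x \<otimes>\<^bsub>wreath G n\<^esub> y = y \<otimes>\<^bsub>wreath G n\<^esub> x"
proof -
  obtain f p h q where xy: "x = (f, p)" "y = (h, q)" by (metis surj_pair)
  have p: "p permutes {1..n}" and q: "q permutes {1..n}"
    and c: "\<And>j. j \<in> {1..n} \<Longrightarrow> f j \<in> carrier G \<and> h j \<in> carrier G"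
    using assms xy by (auto simp: wreath_carrier)
  have triv: "f j = \<one> \<and> p j = j \<or> h j = \<one> \<and> q j = j" if "j \<in> {1..n}" for j
    using assms(3)[OF that] xy by (simp add: trivial_at_def)
  have fixed: "p j = j \<or> q j = j" for j
    using triv[of j] permutes_not_in[OF p, of j] by (cases "j \<in> {1..n}") auto
  have injs: "p u = p v \<Longrightarrow> u = v" "q u = q v \<Longrightarrow> u = v" for u v
    using permutes_inj[OF p] permutes_inj[OF q] by (auto dest: injD)
  have perms: "p \<circ> q = q \<circ> p"
  proof
    fix j
    show "(p \<circ> q) j = (q \<circ> p) j"
      using fixed[of j] fixed[of "p j"] fixed[of "q j"] injs by (metis comp_apply)
  qed
  have labels: "f l \<otimes> h (Hilbert_Choice.inv p l) = h l \<otimes> f (Hilbert_Choice.inv q l)" if l: "l \<in> {1..n}" for l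
  proof -
    let ?u = "Hilbert_Choice.inv p l" and ?v = "Hilbert_Choice.inv q l"
    have uv: "?u \<in> {1..n}" "?v \<in> {1..n}" "p ?u = l" "q ?v = l"
      using l permutes_inv_in[OF p] permutes_inv_in[OF q] permutes_inverses[OF p] permutes_inverses[OF q]
      by auto
    have "f l = \<one> \<and> ?u = l \<or> h l = \<one> \<and> ?v = l"
      using triv[OF l] injs uv by metis
    moreover have "f ?v = \<one> \<or> ?v = l" "h ?u = \<one> \<or> ?u = l"
      using triv[OF uv(1)] triv[OF uv(2)] uv by auto
    ultimately show ?thesis using c[OF l] by auto
  qed
  show ?thesis
    unfolding xy wreath_mult perms using labels by (auto intro!: restrict_ext)
qed

lemma degree_less:
  assumes "k \<in> {1..i}" "\<not> trivial_at x k"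
    and "trivial_at y k" "\<And>j. j \<in> {1..i} \<Longrightarrow> trivial_at x j \<Longrightarrow> trivial_at y j"
  shows "degree i y < degree i x"
  unfolding degree_def using assms by (intro psubset_card_mono) auto

text \<open>The two elements are conjugate under \<open>wreath_subgroup G i n\<close>. The transposition of \<open>k\<close> and \<open>k'\<close>,
  with a label at \<open>k'\<close> that corrects \<open>g\<close> to \<open>g'\<close>, conjugates one twisted transposition
  to the other, and it commutes with \<open>x\<close> because \<open>x\<close> is trivial at both places.\<close>

lemma conj_sum_mult_twist:
  assumes x: "x \<in> carrier (wreath G n)" and i: "Suc i \<le> n"
    and k: "k \<in> {1..i}" "trivial_at x k" and k': "k' \<in> {1..i}" "trivial_at x k'"
    and g: "g \<in> carrier G" "g' \<in> carrier G"
  shows "group.conj_sum (wreath G n) (wreath_subgroup G i n) (x \<otimes>\<^bsub>wreath G n\<^esub> twist n k (Suc i) g) =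
    group.conj_sum (wreath G n) (wreath_subgroup G i n) (x \<otimes>\<^bsub>wreath G n\<^esub> twist n k' (Suc i) g')"
proof -
  interpret W: group "wreath G n" by (rule wreath_group)
  let ?a = "\<lambda>l\<in>{1..n}. if l = k' then inv g' \<otimes> g else \<one>"
  let ?p = "transpose k k'"
  let ?h = "(?a, ?p)"
  let ?t = "twist n k (Suc i) g" and ?t' = "twist n k' (Suc i) g'"
  have h: "?h \<in> carrier (wreath G n)"
    using permutes_swap_id[of k "{1..n}" k'] k k' i g by (auto simp: wreath_carrier)
  then have hH: "?h \<in> wreath_subgroup G i n"
    using k k' by (auto simp: wreath_subgroup_iff)
  have t: "?t \<in> carrier (wreath G n)" "?t' \<in> carrier (wreath G n)"
    using k k' i g by (auto intro: twist_closed)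
  have "trivial_at x l \<or> trivial_at ?h l" if "l \<in> {1..n}" for l
    using that k k' by (cases "l = k \<or> l = k'") (auto simp: trivial_at_def)
  then have hx: "?h \<otimes>\<^bsub>wreath G n\<^esub> x = x \<otimes>\<^bsub>wreath G n\<^esub> ?h"
    using wreath_commute[OF x h] by simp
  have "?a (?p (Suc i)) \<otimes> g \<otimes> inv ?a (?p k) = g'"
    using k k' i g by (simp add: inv_mult_group inv_mult_cancel)
  then have ht: "?h \<otimes>\<^bsub>wreath G n\<^esub> ?t = ?t' \<otimes>\<^bsub>wreath G n\<^esub> ?h"
    using twist_conj[OF h, of k "Suc i" g] k k' i g by simp
  have "?h \<otimes>\<^bsub>wreath G n\<^esub> (x \<otimes>\<^bsub>wreath G n\<^esub> ?t) = ?h \<otimes>\<^bsub>wreath G n\<^esub> x \<otimes>\<^bsub>wreath G n\<^esub> ?t"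
    using h x t by (simp add: W.m_assoc)
  also have "\<dots> = x \<otimes>\<^bsub>wreath G n\<^esub> (?h \<otimes>\<^bsub>wreath G n\<^esub> ?t)"
    unfolding hx using h x t by (simp add: W.m_assoc)
  also have "\<dots> = x \<otimes>\<^bsub>wreath G n\<^esub> ?t' \<otimes>\<^bsub>wreath G n\<^esub> ?h"
    unfolding ht using h x t by (simp add: W.m_assoc)
  finally show ?thesis
    using x t hH by (intro W.conj_sum_conj[where g = ?h] subgroup_wreath_subgroup) auto
qed

text \<open>Take for \<open>k\<close> the image of \<open>Suc i\<close> under the permutation of \<open>x\<close>. Multiplying by a transposition
  of \<open>k\<close> and \<open>Suc i\<close> makes \<open>k\<close> a fixed point, and the twist is chosen to cancel the label of \<open>x\<close> at
  \<open>k\<close>. No other place in \<open>{1..i}\<close> becomes nontrivial. Twisted transpositions are involutions, so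
  the multiplication can be undone by the same factor.\<close>

lemma split_off_twist:
  assumes x: "x \<in> wreath_subgroup G (Suc i) n" and i: "Suc i \<le> n" and moved: "snd x (Suc i) \<noteq> Suc i"
  obtains y k g where "y \<in> wreath_subgroup G (Suc i) n" "k \<in> {1..i}" "g \<in> carrier G"
    "x = y \<otimes>\<^bsub>wreath G n\<^esub> twist n k (Suc i) g" "trivial_at y k" "degree i y < degree i x"
proof -
  interpret W: group "wreath G n" by (rule wreath_group)
  obtain f p where fp: "x = (f, p)" by (cases x)
  have xc: "x \<in> carrier (wreath G n)" using x by (auto simp: wreath_subgroup_def)
  have p: "p permutes {1..Suc i}" using x wreath_subgroup_permutes unfolding fp by blast
  have pn: "p permutes {1..n}" and f: "\<And>l. l \<in> {1..n} \<Longrightarrow> f l \<in> carrier G"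
    using xc by (auto simp: fp wreath_carrier)
  define k where "k = p (Suc i)"
  have k: "k \<in> {1..i}"
    using permutes_in_image[OF p, of "Suc i"] moved by (auto simp: fp k_def)
  define t where "t = twist n k (Suc i) (inv f k)"
  define y where "y = x \<otimes>\<^bsub>wreath G n\<^esub> t"
  have fk: "f k \<in> carrier G" using f k i by auto
  have tc: "t \<in> carrier (wreath G n)"
    unfolding t_def using k i fk by (intro twist_closed) auto
  have tH: "t \<in> wreath_subgroup G (Suc i) n"
    using tc k by (auto simp: t_def twist_def wreath_subgroup_iff)
  have yH: "y \<in> wreath_subgroup G (Suc i) n"
    unfolding y_def using subgroup.m_closed[OF subgroup_wreath_subgroup x tH] .
  have "t \<otimes>\<^bsub>wreath G n\<^esub> t = \<one>\<^bsub>wreath G n\<^esub>"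
    unfolding t_def using k i fk by (intro twist_twist) auto
  then have xy: "x = y \<otimes>\<^bsub>wreath G n\<^esub> t"
    unfolding y_def using xc tc by (simp add: W.m_assoc)
  have "Hilbert_Choice.inv p k = Suc i" using permutes_inverses[OF p] by (simp add: k_def)
  then have yk: "trivial_at y k"
    using k i fk by (simp add: trivial_at_def y_def fp t_def twist_def wreath_mult k_def[symmetric])
  have "p k \<noteq> k" using permutes_inj[OF p] k by (metis atLeastAtMost_iff injD k_def not_less_eq_eq order_refl)
  then have xk: "\<not> trivial_at x k" by (simp add: trivial_at_def fp)
  have "trivial_at y j" if "j \<in> {1..i}" "trivial_at x j" for j
    unfolding y_def
  proof (rule trivial_at_mult[OF xc])
    show "trivial_at t j"
      unfolding t_def using that xk i by (intro trivial_at_twist) auto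
  qed (use that i in auto)
  then have "degree i y < degree i x" using degree_less[OF k xk yk] by blast
  with that yH k fk xy yk show thesis unfolding t_def by blast
qed

text \<open>The heart of the proof: the terms of highest degree in \<open>P(y) X\<^sub>i\<^sub>+\<^sub>1\<close> are all equal to \<open>P(x)\<close>.\<close>

lemma conj_sum_in_subalgebra:
  assumes fin: "finite (carrier G)" and i: "Suc i \<le> n"
    and V: "unital_subalgebra V (group_algebra (wreath G n))"
    and ZV: "Z_wreath G i n \<subseteq> V" and XV: "YJM G n (Suc i) \<in> V"
    and x: "x \<in> wreath_subgroup G (Suc i) n"
  shows "group.conj_sum (wreath G n) (wreath_subgroup G i n) x \<in> V"
  using x
proof (induction "degree i x" arbitrary: x rule: less_induct)
  case less
  interpret W: group "wreath G n" by (rule wreath_group)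
  let ?H = "wreath_subgroup G i n" and ?T = "twists_to n (Suc i)"
  have H: "subgroup ?H (wreath G n)" by (rule subgroup_wreath_subgroup)
  have finW: "finite (carrier (wreath G n))" using fin by (rule finite_wreath)
  show ?case
  proof (cases "snd x (Suc i) = Suc i")
    case True
    have "x \<in> ?H"
    proof -
      obtain f p where fp: "x = (f, p)" by (cases x)
      have "p j = j" if "j \<in> {i + 1..n}" for j
        using that less.prems True by (cases "j = Suc i") (auto simp: fp wreath_subgroup_iff)
      then show ?thesis using less.prems by (auto simp: fp wreath_subgroup_iff)
    qed
    then show ?thesis
      using W.conj_sum_in_center[OF H finW] ZV unfolding Z_wreath_def by blast
  next
    case False
    then obtain y k g where y: "y \<in> wreath_subgroup G (Suc i) n" "k \<in> {1..i}" "g \<in> carrier G"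
      "x = y \<otimes>\<^bsub>wreath G n\<^esub> twist n k (Suc i) g" "trivial_at y k" "degree i y < degree i x"
      using split_off_twist[OF less.prems i] by metis
    have yc: "y \<in> carrier (wreath G n)" using y by (auto simp: wreath_subgroup_def)
    \<comment> \<open>the twisted transpositions whose product with \<open>y\<close> is conjugate to \<open>x\<close>\<close>
    define T1 where "T1 = {twist n k' (Suc i) g' | k' g'. k' \<in> {1..i} \<and> trivial_at y k' \<and> g' \<in> carrier G}"
    have T1: "T1 \<subseteq> ?T" by (fastforce simp: T1_def twists_to_def)
    have finT: "finite ?T" using finite_subset[OF twists_to_closed[OF i] finW] .
    have same: "W.conj_sum ?H (y \<otimes>\<^bsub>wreath G n\<^esub> t) = W.conj_sum ?H x" if "t \<in> T1" for t
      using that conj_sum_mult_twist[OF yc i _ _ y(2,5) _ y(3)] unfolding y(4) T1_def by auto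
    have lower: "W.conj_sum ?H (y \<otimes>\<^bsub>wreath G n\<^esub> t) \<in> V" if t: "t \<in> ?T - T1" for t
    proof -
      obtain k' g' where t': "t = twist n k' (Suc i) g'" "k' \<in> {1..i}" "g' \<in> carrier G"
        using t by (auto simp: twists_to_def)
      have k': "\<not> trivial_at y k'" using t t' by (auto simp: T1_def)
      have tc: "t \<in> carrier (wreath G n)" using t twists_to_closed[OF i] by blast
      then have "t \<in> wreath_subgroup G (Suc i) n"
        using t' by (auto simp: twist_def wreath_subgroup_iff)
      then have ytH: "y \<otimes>\<^bsub>wreath G n\<^esub> t \<in> wreath_subgroup G (Suc i) n"
        using subgroup.m_closed[OF subgroup_wreath_subgroup y(1)] by blast
      have "trivial_at (y \<otimes>\<^bsub>wreath G n\<^esub> t) j" if "j \<in> {1..i}" "trivial_at y j" for j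
      proof (rule trivial_at_mult[OF yc])
        show "trivial_at t j"
          unfolding t'(1) using that k' i by (intro trivial_at_twist) auto
      qed (use that i in auto)
      then have "degree i (y \<otimes>\<^bsub>wreath G n\<^esub> t) \<le> degree i y"
        unfolding degree_def by (intro card_mono) auto
      then show ?thesis using less.hyps[OF _ ytH] y(6) by simp
    qed
    have prod: "W.conj_sum ?H y \<otimes>\<^bsub>group_algebra (wreath G n)\<^esub> YJM G n (Suc i) =
      (\<lambda>z. \<Sum>t\<in>?T. W.conj_sum ?H (y \<otimes>\<^bsub>wreath G n\<^esub> t) z)"
      unfolding YJM_eq[OF fin i]
      by (rule W.conj_sum_mult[OF H finW yc twists_to_closed[OF i] twists_to_conj[OF i]])
    have prodV: "(\<lambda>z. \<Sum>t\<in>?T. W.conj_sum ?H (y \<otimes>\<^bsub>wreath G n\<^esub> t) z) \<in> V"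
      unfolding prod[symmetric]
      using unital_subalgebra_closed(3)[OF V less.hyps[OF y(6,1)] XV] .
    have lowerV: "(\<lambda>z. \<Sum>t\<in>?T - T1. W.conj_sum ?H (y \<otimes>\<^bsub>wreath G n\<^esub> t) z) \<in> V"
      by (rule unital_subalgebra_closed(6)[OF V]) (use finT lower in auto)
    have "(\<lambda>z. (\<Sum>t\<in>?T. W.conj_sum ?H (y \<otimes>\<^bsub>wreath G n\<^esub> t) z) -
        (\<Sum>t\<in>?T - T1. W.conj_sum ?H (y \<otimes>\<^bsub>wreath G n\<^esub> t) z)) \<in> V" (is "?D \<in> V")
      by (rule unital_subalgebra_closed(4)[OF V prodV lowerV])
    also have "?D = (\<lambda>z. of_nat (card T1) * W.conj_sum ?H x z)"
      using same by (simp add: sum.subset_diff[OF T1 finT])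
    finally have multiple: "(\<lambda>z. of_nat (card T1) * W.conj_sum ?H x z) \<in> V" .
    have "twist n k (Suc i) g \<in> T1"
      unfolding T1_def using y by blast
    then have "card T1 \<noteq> 0"
      using finite_subset[OF T1 finT] by auto
    then show ?thesis using unital_subalgebra_closed(5)[OF V multiple] by simp
  qed
qed

section \<open>Centres and Young-Jucys-Murphy elements\<close>

text \<open>An element of the larger centre commutes in particular with the smaller subgroup, so averaging
  over that subgroup reduces the claim to conjugate sums.\<close>

lemma Z_wreath_Suc_subset:
  assumes fin: "finite (carrier G)" and i: "Suc i \<le> n"
    and V: "unital_subalgebra V (group_algebra (wreath G n))"
    and ZV: "Z_wreath G i n \<subseteq> V" and XV: "YJM G n (Suc i) \<in> V"
  shows "Z_wreath G (Suc i) n \<subseteq> V"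
proof
  interpret W: group "wreath G n" by (rule wreath_group)
  let ?H = "wreath_subgroup G i n" and ?L = "wreath_subgroup G (Suc i) n"
  have H: "subgroup ?H (wreath G n)" and L: "subgroup ?L (wreath G n)" and HL: "?H \<subseteq> ?L"
    by (simp_all add: subgroup_wreath_subgroup wreath_subgroup_mono)
  have finW: "finite (carrier (wreath G n))" using fin by (rule finite_wreath)
  have finL: "finite ?L" using finite_subset[OF subgroup.subset[OF L] finW] .
  have K: "group ((wreath G n)\<lparr>carrier := ?L\<rparr>)"
    by (rule subgroup.subgroup_is_group[OF L wreath_group])
  fix a assume "a \<in> Z_wreath G (Suc i) n"
  then have a: "\<And>x. x \<notin> ?L \<Longrightarrow> a x = 0"
    "\<And>x y. x \<in> ?L \<Longrightarrow> y \<in> ?L \<Longrightarrow> a (x \<otimes>\<^bsub>wreath G n\<^esub> y) = a (y \<otimes>\<^bsub>wreath G n\<^esub> x)"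
    using group.center_group_algebra[OF K] finL by (auto simp: Z_wreath_def)
  have "(\<lambda>y. \<Sum>x\<in>?L. a x * W.conj_sum ?H x y) \<in> V"
    by (intro unital_subalgebra_closed(2,6)[OF V] finL conj_sum_in_subalgebra[OF fin i V ZV XV])
  also have "(\<lambda>y. \<Sum>x\<in>?L. a x * W.conj_sum ?H x y) = (\<lambda>y. of_nat (card ?H) * a y)"
    using W.conj_sum_average[OF H L HL finW, of a] a HL by (auto simp: subset_iff)
  finally have multiple: "(\<lambda>y. of_nat (card ?H) * a y) \<in> V" .
  have "card ?H \<noteq> 0"
    using finite_subset[OF HL finL] subgroup.one_closed[OF H] by auto
  then show "a \<in> V" using unital_subalgebra_closed(5)[OF V multiple] by simp
qed

text \<open>The twisted transpositions in \<open>wreath_subgroup G (Suc i) n\<close> that do not already lie in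
  \<open>wreath_subgroup G i n\<close> are exactly those involving \<open>Suc i\<close>, which sum to the
  Young-Jucys-Murphy element.\<close>

lemma YJM_in_subalgebra:
  assumes fin: "finite (carrier G)" and i: "Suc i \<le> n"
    and V: "unital_subalgebra V (group_algebra (wreath G n))"
    and ZV: "Z_wreath G i n \<subseteq> V" "Z_wreath G (Suc i) n \<subseteq> V"
  shows "YJM G n (Suc i) \<in> V"
proof -
  interpret W: group "wreath G n" by (rule wreath_group)
  have Z: "(\<lambda>x. of_bool (x \<in> twists_upto n j)) \<in> Z_wreath G j n" if "j \<le> n" for j
    unfolding Z_wreath_def
    by (rule W.indicator_in_center[OF subgroup_wreath_subgroup finite_wreath[OF fin]
          twists_upto_subset[OF that] twists_upto_conj[OF that]])
  have "YJM G n (Suc i) = (\<lambda>x. of_bool (x \<in> twists_upto n (Suc i)) - of_bool (x \<in> twists_upto n i))"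
    unfolding YJM_eq[OF fin i] twists_upto_Suc using twists_disjoint[of n i] by (auto simp: fun_eq_iff)
  also have "\<dots> \<in> V"
    using Z[of i] Z[of "Suc i"] i ZV by (intro unital_subalgebra_closed(4)[OF V]) auto
  finally show ?thesis .
qed

lemma YJM_1_in_subalgebra:
  assumes V: "unital_subalgebra V (group_algebra (wreath G n))"
  shows "YJM G n 1 \<in> V"
proof -
  interpret abelian_monoid "group_algebra (wreath G n)" by (rule abelian_monoid_group_algebra)
  have "YJM G n 1 = (\<lambda>x. 0)" by (simp add: YJM_def group_algebra_simps)
  then show ?thesis using unital_subalgebra_closed(6)[OF V, of "{}"] by simp
qed

lemma Z_base_eq:
  assumes fin: "finite (carrier G)"
  shows "Z_base G n = Z_wreath G 1 n"
proof -
  let ?P = "product_group {1..n} (\<lambda>_. G)"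
  interpret P: group ?P by (rule product_group) (rule is_group)
  have finP: "finite (carrier ?P)" using fin by (simp add: finite_PiE)
  have hom: "base_elt \<in> hom ?P (wreath G n)"
    by (rule homI) (auto simp: base_elt_def wreath_carrier wreath_mult permutes_id)
  have inj: "inj_on base_elt (carrier ?P)" by (auto simp: inj_on_def base_elt_def)
  have "base_elt ` carrier ?P = wreath_subgroup G 1 n"
  proof (intro equalityI subsetI)
    fix x assume x: "x \<in> wreath_subgroup G 1 n"
    obtain f p where fp: "x = (f, p)" by (cases x)
    have "p permutes {1}" using wreath_subgroup_permutes x unfolding fp by fastforce
    then have "p = id" by simp
    then show "x \<in> base_elt ` carrier ?P"
      using x by (auto simp: fp base_elt_def wreath_subgroup_iff wreath_carrier)
  qed (auto simp: base_elt_def wreath_subgroup_iff wreath_carrier permutes_id)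
  then show ?thesis
    unfolding Z_base_def Z_wreath_def
    using P.group_algebra_map_center[OF wreath_group finP hom inj] by simp
qed

lemma subalgebra_contains_iff:
  assumes fin: "finite (carrier G)" and m: "1 \<le> m" "m \<le> n"
    and V: "unital_subalgebra V (group_algebra (wreath G n))"
  shows "(\<Union>i\<in>{1..m}. Z_wreath G i n) \<subseteq> V \<longleftrightarrow> Z_base G n \<union> YJM G n ` {1..m} \<subseteq> V"
  using m
proof (induction m rule: nat_induct_at_least)
  case base
  then show ?case using YJM_1_in_subalgebra[OF V] Z_base_eq[OF fin] m by simp
next
  case (Suc m)
  have IH: "(\<Union>i\<in>{1..m}. Z_wreath G i n) \<subseteq> V \<longleftrightarrow> Z_base G n \<union> YJM G n ` {1..m} \<subseteq> V"
    using Suc by simp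
  have new: "Z_wreath G (Suc m) n \<subseteq> V \<longleftrightarrow> YJM G n (Suc m) \<in> V" if "Z_wreath G m n \<subseteq> V"
    using Z_wreath_Suc_subset[OF fin _ V that] YJM_in_subalgebra[OF fin _ V that] Suc by auto
  have "Z_wreath G m n \<subseteq> V" if "(\<Union>i\<in>{1..m}. Z_wreath G i n) \<subseteq> V"
    using that Suc.hyps by (simp add: UN_subset_iff)
  then have "(\<Union>i\<in>{1..m}. Z_wreath G i n) \<subseteq> V \<and> Z_wreath G (Suc m) n \<subseteq> V \<longleftrightarrow>
      Z_base G n \<union> YJM G n ` {1..m} \<subseteq> V \<and> YJM G n (Suc m) \<in> V"
    using IH new by blast
  moreover have "{1..Suc m} = insert (Suc m) {1..m}" by auto
  ultimately show ?case by auto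
qed

end

theorem theorem4p4:
  fixes G :: "('a, 'b) monoid_scheme" and m n :: nat
  assumes "group G" and "finite (carrier G)"
    and "n \<ge> 1" and "1 \<le> m" and "m \<le> n"
  shows "GZ_wreath G m n =
    generated_subalgebra (group_algebra (wreath G n)) (Z_base G n \<union> YJM G n ` {1..m})"
  unfolding GZ_wreath_def generated_subalgebra_def
  by (intro arg_cong[where f = Inter] Collect_cong conj_cong refl
      group.subalgebra_contains_iff[OF assms(1,2,4,5)])

end
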